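(* There is no nfs-irreducible clause-irreducible unsatisfiable hitting clause-set of deficiency $2$; i.e., every clause-irreducible unsatisfiable hitting clause-set $F$ with $\delta(F)=2$ can be transformed by a finite sequence of nfs-flips into a clause-reducible clause-set.
   Context: Variables are positive integers, literals are nonzero integers, the complement of $x$ is $\overline{x}=-x$, $\mathrm{var}(x)=|x|$. A clause is a finite set of literals with no pair $x,\overline{x}$. A clause-set is a finite set of clauses; $\top$ is the empty clause-set. $n(F)$ is the number of variables occurring in $F$, $c(F)=|F|$, $\delta(F)=c(F)-n(F)$. $F$ is satisfiable if some clause meets every clause of $F$, otherwise unsatisfiable. $F$ is hitting if any two distinct clauses $C,D\in F$ have some $x\in C$ with $\overline{x}\in D$. A clause-set $F'\ne\top$ is a clause-factor if $\{D\setminus\bigcap F':D\in F'\}$ is unsatisfiable; a clause-factor of $F$ is a subset of $F$ which is a clause-factor; trivial if $c(F')=1$ or ($F'$ unsatisfiable and $F'=F$). $F$ is clause-irreducible if all its clause-factors are trivial, else clause-reducible. An nfs-pair is $\{E\cup\{x\},E\cup\{\overline{x},y\}\}$ with $E$ a clause, $\mathrm{var}(x)\ne\mathrm{var}(y)$, $x,\overline x,y,\overline y\notin E$; its nfs-flip is $\{E\cup\{x,\overline y\},E\cup\{y\}\}$. An nfs-flip on $F$ replaces an nfs-pair $P\subseteq F$, neither of whose flip clauses lies in $F$, by its nfs-flip. *)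

theory Defs
  imports Main
begin

(* Literals are the nonzero integers, the complement of x is - x, and the variable of x
   is its absolute value. *)

type_synonym literal = int
type_synonym clause = "literal set"

definition is_clause :: "clause \<Rightarrow> bool" where
  "is_clause C \<longleftrightarrow> finite C \<and> 0 \<notin> C \<and> (\<forall>x\<in>C. - x \<notin> C)"

definition is_clause_set :: "clause set \<Rightarrow> bool" where
  "is_clause_set F \<longleftrightarrow> finite F \<and> (\<forall>C\<in>F. is_clause C)"

definition variables :: "clause set \<Rightarrow> int set" where
  "variables F = abs ` \<Union>F"

definition deficiency :: "clause set \<Rightarrow> int" where
  "deficiency F = int (card F) - int (card (variables F))"

definition satisfiable :: "clause set \<Rightarrow> bool" where
  "satisfiable F \<longleftrightarrow> (\<exists>C. is_clause C \<and> (\<forall>D\<in>F. C \<inter> D \<noteq> {}))"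

abbreviation unsatisfiable :: "clause set \<Rightarrow> bool" where
  "unsatisfiable F \<equiv> \<not> satisfiable F"

definition hitting :: "clause set \<Rightarrow> bool" where
  "hitting F \<longleftrightarrow> (\<forall>C\<in>F. \<forall>D\<in>F. C \<noteq> D \<longrightarrow> (\<exists>x\<in>C. - x \<in> D))"

definition clause_factor :: "clause set \<Rightarrow> bool" where
  "clause_factor F' \<longleftrightarrow>
     is_clause_set F' \<and> F' \<noteq> {} \<and> unsatisfiable ((\<lambda>D. D - \<Inter>F') ` F')"

definition clause_factor_of :: "clause set \<Rightarrow> clause set \<Rightarrow> bool" where
  "clause_factor_of F' F \<longleftrightarrow> F' \<subseteq> F \<and> clause_factor F'"

definition trivial_clause_factor_of :: "clause set \<Rightarrow> clause set \<Rightarrow> bool" where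
  "trivial_clause_factor_of F' F \<longleftrightarrow>
     clause_factor_of F' F \<and> (card F' = 1 \<or> (unsatisfiable F' \<and> F' = F))"

definition clause_irreducible :: "clause set \<Rightarrow> bool" where
  "clause_irreducible F \<longleftrightarrow>
     is_clause_set F \<and> (\<forall>F'. clause_factor_of F' F \<longrightarrow> trivial_clause_factor_of F' F)"

definition clause_reducible :: "clause set \<Rightarrow> bool" where
  "clause_reducible F \<longleftrightarrow> is_clause_set F \<and> \<not> clause_irreducible F"

definition nfs_data :: "clause \<Rightarrow> literal \<Rightarrow> literal \<Rightarrow> bool" where
  "nfs_data E x y \<longleftrightarrow>
     is_clause E \<and> x \<noteq> 0 \<and> y \<noteq> 0 \<and> \<bar>x\<bar> \<noteq> \<bar>y\<bar> \<and>
     x \<notin> E \<and> - x \<notin> E \<and> y \<notin> E \<and> - y \<notin> E"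

definition nfs_pair :: "clause \<Rightarrow> literal \<Rightarrow> literal \<Rightarrow> clause set" where
  "nfs_pair E x y = {E \<union> {x}, E \<union> {- x, y}}"

definition nfs_flipped_pair :: "clause \<Rightarrow> literal \<Rightarrow> literal \<Rightarrow> clause set" where
  "nfs_flipped_pair E x y = {E \<union> {x, - y}, E \<union> {y}}"

(* An nfs-pair determines E, x and y (its two clauses have different sizes), so quantifying
   over E, x, y is the same as quantifying over the nfs-pairs contained in F. *)
definition nfs_flip :: "clause set \<Rightarrow> clause set \<Rightarrow> bool" where
  "nfs_flip F G \<longleftrightarrow>
     (\<exists>E x y. nfs_data E x y \<and> nfs_pair E x y \<subseteq> F \<and> nfs_flipped_pair E x y \<inter> F = {} \<and>
        G = (F - nfs_pair E x y) \<union> nfs_flipped_pair E x y)"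

definition nfs_irreducible :: "clause set \<Rightarrow> bool" where
  "nfs_irreducible F \<longleftrightarrow>
     is_clause_set F \<and> \<not> (\<exists>G. nfs_flip\<^sup>*\<^sup>* F G \<and> clause_reducible G)"

end

theory Submission
  imports Defs
begin

text \<open>
  Identify a clause with the subcube of assignments falsifying it; an unsatisfiable hitting
  clause-set is then a partition of the cube. Setting a variable \<open>v\<close> of minimal degree to
  a truth value makes no other variable disappear, since such a variable would have smaller degree.
  By induction the deficiency is therefore at least 1, and each literal of \<open>v\<close> occurs at
  most as often as the deficiency. In deficiency 2 both literals thus occur once or twice.
  If one of them occurs once, there is a nontrivial clause-factor. If both occur twice, a union of
  two disjoint subcubes is decomposed in two ways; unless there is a clause-factor already, the
  decompositions are related by an nfs-flip, and flipping one of them creates two clauses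
  \<open>C \<union> {v}\<close>, \<open>C \<union> {- v}\<close>, which form a clause-factor.
\<close>

section \<open>Total assignments\<close>

(* T is the set of falsified literals, so a clause C is falsified iff C is a subset of T. *)
definition assignment :: "literal set \<Rightarrow> bool" where
  "assignment T \<longleftrightarrow> (\<forall>x. x \<noteq> 0 \<longrightarrow> (- x \<in> T \<longleftrightarrow> x \<notin> T))"

text \<open>Moves \<open>T\<close> into the subcube of \<open>C\<close>: the literals of
  \<open>C\<close> become falsified, every other variable keeps its value.\<close>

definition override :: "literal set \<Rightarrow> clause \<Rightarrow> literal set" where
  "override T C = C \<union> {x \<in> T. - x \<notin> C}"

lemma is_clause_zero: "is_clause C \<Longrightarrow> 0 \<notin> C"
  and is_clause_finite: "is_clause C \<Longrightarrow> finite C"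
  and is_clause_uminus: "is_clause C \<Longrightarrow> x \<in> C \<Longrightarrow> - x \<notin> C"
  by (auto simp: is_clause_def)

lemma is_clause_subset: "is_clause C \<Longrightarrow> D \<subseteq> C \<Longrightarrow> is_clause D"
  unfolding is_clause_def by (meson finite_subset subset_iff)

lemma is_clause_insert:
  "is_clause C \<Longrightarrow> x \<noteq> 0 \<Longrightarrow> - x \<notin> C \<Longrightarrow> is_clause (insert x C)"
  unfolding is_clause_def by auto

lemma assignment_uminus: "assignment T \<Longrightarrow> x \<noteq> 0 \<Longrightarrow> - x \<in> T \<longleftrightarrow> x \<notin> T"
  by (auto simp: assignment_def)

lemma assignment_override:
  assumes "assignment T" "is_clause C"
  shows "assignment (override T C)"
  using assms unfolding assignment_def override_def is_clause_def by auto

lemma subset_override: "C \<subseteq> override T C"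
  by (auto simp: override_def)

lemma assignment_positive: "assignment {x. x > 0}"
  by (auto simp: assignment_def)

lemma assignment_extending:
  assumes "is_clause C"
  obtains T where "assignment T" "C \<subseteq> T"
  using assignment_override[OF assignment_positive assms] subset_override by blast

lemma assignment_avoiding:
  assumes "is_clause C" "x \<noteq> 0" "x \<notin> C"
  obtains T where "assignment T" "C \<subseteq> T" "x \<notin> T"
proof -
  have "is_clause (insert (- x) C)"
    using assms by (intro is_clause_insert) auto
  then obtain T where "assignment T" "insert (- x) C \<subseteq> T"
    by (rule assignment_extending)
  then show thesis
    using that assms(2) assignment_uminus by auto
qed

text \<open>A literal of \<open>D\<close> outside \<open>C\<close> could be kept true by some
  assignment extending \<open>C\<close>, so inclusion of subcubes reverses inclusion of clauses. The
  literal 0 is excluded because \<open>assignment\<close> leaves its membership open.\<close>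

lemma clause_subset_if_implied:
  assumes "is_clause C" "0 \<notin> D" "\<And>T. assignment T \<Longrightarrow> C \<subseteq> T \<Longrightarrow> D \<subseteq> T"
  shows "D \<subseteq> C"
proof
  fix x assume "x \<in> D"
  with assms(2) have "x \<noteq> 0" by auto
  show "x \<in> C"
  proof (rule ccontr)
    assume "x \<notin> C"
    from assignment_avoiding[OF assms(1) \<open>x \<noteq> 0\<close> this] assms(3) \<open>x \<in> D\<close>
    show False by blast
  qed
qed

lemma unsatisfiable_iff:
  assumes "is_clause_set F"
  shows "unsatisfiable F \<longleftrightarrow> (\<forall>T. assignment T \<longrightarrow> (\<exists>C\<in>F. C \<subseteq> T))"
proof
  assume unsat: "unsatisfiable F"
  show "\<forall>T. assignment T \<longrightarrow> (\<exists>C\<in>F. C \<subseteq> T)"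
  proof (intro allI impI, rule ccontr)
    fix T assume T: "assignment T" and no: "\<not> (\<exists>C\<in>F. C \<subseteq> T)"
    \<comment> \<open>The literals true under \<open>T\<close>, cut down to those occurring in
      \<open>F\<close> so that the set is finite.\<close>
    let ?S = "{x \<in> \<Union>F. x \<notin> T}"
    have "finite ?S" "0 \<notin> ?S"
      using assms by (auto simp: is_clause_set_def is_clause_def)
    moreover have "- x \<notin> ?S" if "x \<in> ?S" for x
      using that \<open>0 \<notin> ?S\<close> assignment_uminus[OF T, of x] by auto
    ultimately have "is_clause ?S"
      unfolding is_clause_def by blast
    moreover have "\<forall>D\<in>F. ?S \<inter> D \<noteq> {}"
      using no by blast
    ultimately show False
      using unsat by (auto simp: satisfiable_def)
  qed
next
  assume ex: "\<forall>T. assignment T \<longrightarrow> (\<exists>C\<in>F. C \<subseteq> T)"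
  show "unsatisfiable F"
  proof
    assume "satisfiable F"
    then obtain C where C: "is_clause C" "\<forall>D\<in>F. C \<inter> D \<noteq> {}"
      by (auto simp: satisfiable_def)
    \<comment> \<open>A satisfying clause lists true literals, an assignment falsified ones; hence
      the complements.\<close>
    have "is_clause (uminus ` C)"
      using C(1) unfolding is_clause_def by force
    then obtain T where T: "assignment T" "uminus ` C \<subseteq> T"
      by (rule assignment_extending)
    with ex obtain D where D: "D \<in> F" "D \<subseteq> T" by blast
    with C(2) obtain x where "x \<in> C" "x \<in> D" by blast
    with D T is_clause_zero[OF C(1)] assignment_uminus[OF T(1), of x] show False by auto
  qed
qed

section \<open>Unsatisfiable hitting clause-sets\<close>

definition uhit :: "clause set \<Rightarrow> bool" where
  "uhit F \<longleftrightarrow> is_clause_set F \<and> unsatisfiable F \<and> hitting F"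

lemma uhit_clause: "uhit F \<Longrightarrow> C \<in> F \<Longrightarrow> is_clause C"
  and uhit_finite: "uhit F \<Longrightarrow> finite F"
  by (auto simp: uhit_def is_clause_set_def)

lemma uhit_ex: "uhit F \<Longrightarrow> assignment T \<Longrightarrow> \<exists>C\<in>F. C \<subseteq> T"
  using unsatisfiable_iff by (auto simp: uhit_def)

text \<open>No assignment contains both sides of a clash. Together with \<open>uhit_ex\<close> this
  says that the subcubes of the clauses partition the cube.\<close>

lemma uhit_unique:
  assumes "uhit F" "assignment T" "C \<in> F" "D \<in> F" "C \<subseteq> T" "D \<subseteq> T"
  shows "C = D"
proof (rule ccontr)
  assume "C \<noteq> D"
  with assms obtain x where x: "x \<in> C" "- x \<in> D"
    unfolding uhit_def hitting_def by meson
  with uhit_clause[OF assms(1,3)] have "x \<noteq> 0" by (auto dest: is_clause_zero)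
  with x assms assignment_uminus[of T x] show False by auto
qed

lemma finite_variables: "is_clause_set F \<Longrightarrow> finite (variables F)"
  unfolding variables_def is_clause_set_def by (auto dest: is_clause_finite)

(* Flipping x in an assignment falsifying C must falsify another clause, which contains - x. *)
lemma uhit_flip_literal:
  assumes F: "uhit F" and C: "C \<in> F" "x \<in> C" and T: "assignment T" "C - {x} \<subseteq> T"
  obtains D where "D \<in> F" "- x \<in> D" "D - {- x} \<subseteq> T"
proof -
  have cl: "is_clause C" by (rule uhit_clause[OF F C(1)])
  then have x: "x \<noteq> 0" "- x \<notin> C"
    using C by (auto simp: is_clause_def)
  let ?T = "override T {x}" and ?U = "override T {- x}"
  have T': "assignment ?T" and U: "assignment ?U"
    using x(1) T(1) by (auto intro!: assignment_override simp: is_clause_def)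
  from uhit_ex[OF F U] obtain D where D: "D \<in> F" "D \<subseteq> ?U" by blast
  have "C \<subseteq> ?T"
    using T(2) x by (auto simp: override_def)
  moreover have "C \<noteq> D"
    using D(2) C(2) x(1) by (auto simp: override_def)
  ultimately have "\<not> D \<subseteq> ?T"
    using uhit_unique[OF F T' C(1) D(1)] by blast
  then have "- x \<in> D"
    using D(2) by (auto simp: override_def)
  then show thesis
    using that D by (auto simp: override_def)
qed

lemma uhit_complement_occurs:
  assumes F: "uhit F" and C: "C \<in> F" "x \<in> C"
  obtains D where "D \<in> F" "- x \<in> D"
proof -
  obtain T where T: "assignment T" "C \<subseteq> T"
    using assignment_extending[OF uhit_clause[OF F C(1)]] .
  then have "C - {x} \<subseteq> T" by blast
  then show thesis
    using that uhit_flip_literal[OF F C T(1)] by blast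
qed

section \<open>Restriction by setting one literal to true\<close>

definition set_true :: "literal \<Rightarrow> clause set \<Rightarrow> clause set" where
  "set_true x F = (\<lambda>C. C - {- x}) ` {C \<in> F. x \<notin> C}"

definition occurrences :: "literal \<Rightarrow> clause set \<Rightarrow> clause set" where
  "occurrences x F = {C \<in> F. x \<in> C}"

lemma finite_occurrences: "uhit F \<Longrightarrow> finite (occurrences x F)"
  by (simp add: uhit_finite occurrences_def)

text \<open>A clash of two clauses avoiding \<open>x\<close> cannot use the variable of
  \<open>x\<close>, so it survives the deletion of \<open>- x\<close>. Hence \<open>set_true\<close>
  preserves hitting and identifies no clauses.\<close>

lemma hitting_off_literal:
  assumes F: "uhit F" "C \<in> F" "D \<in> F" "x \<notin> C" "x \<notin> D" "C \<noteq> D"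
  shows "\<exists>y \<in> C - {- x}. - y \<in> D - {- x}"
proof -
  obtain y where y: "y \<in> C" "- y \<in> D"
    using F by (auto simp: uhit_def hitting_def)
  then have "y \<noteq> - x" "- y \<noteq> - x"
    using F(4,5) by auto
  with y show ?thesis by blast
qed

lemma inj_on_set_true:
  assumes "uhit F"
  shows "inj_on (\<lambda>C. C - {- x}) {C \<in> F. x \<notin> C}"
proof (rule inj_onI, rule ccontr)
  fix C D assume *: "C \<in> {C \<in> F. x \<notin> C}" "D \<in> {C \<in> F. x \<notin> C}"
    "C - {- x} = D - {- x}" "C \<noteq> D"
  then obtain y where "y \<in> C - {- x}" "- y \<in> D - {- x}"
    using hitting_off_literal[OF assms, of C D x] by auto
  with *(3) have "y \<in> D" "- y \<in> D" by auto
  then show False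
    using uhit_clause[OF assms, of D] *(2) by (auto dest: is_clause_uminus)
qed

lemma uhit_set_true:
  assumes F: "uhit F" and x: "x \<noteq> 0"
  shows "uhit (set_true x F)"
proof -
  have cs: "is_clause_set (set_true x F)"
    using F is_clause_subset[OF uhit_clause[OF F]]
    by (auto simp: set_true_def is_clause_set_def uhit_finite)
  moreover have "unsatisfiable (set_true x F)"
    unfolding unsatisfiable_iff[OF cs]
  proof (intro allI impI)
    fix T assume T: "assignment T"
    \<comment> \<open>This assignment makes \<open>x\<close> true, so the clause of \<open>F\<close>
      falsified by it avoids \<open>x\<close> and survives, shortened, in the restriction.\<close>
    have "assignment (override T {- x})"
      using x T by (auto intro!: assignment_override simp: is_clause_def)
    then obtain C where C: "C \<in> F" "C \<subseteq> override T {- x}"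
      using uhit_ex[OF F] by blast
    then have "x \<notin> C" "C - {- x} \<subseteq> T"
      using x by (auto simp: override_def)
    then show "\<exists>C\<in>set_true x F. C \<subseteq> T"
      using C(1) by (auto simp: set_true_def)
  qed
  moreover have "hitting (set_true x F)"
    unfolding hitting_def set_true_def
    using hitting_off_literal[OF F, of _ _ x] by blast
  ultimately show ?thesis by (simp add: uhit_def)
qed

lemma card_set_true:
  assumes "uhit F"
  shows "card (set_true x F) + card (occurrences x F) = card F"
proof -
  have "card (set_true x F) = card {C \<in> F. x \<notin> C}"
    unfolding set_true_def by (rule card_image[OF inj_on_set_true[OF assms]])
  moreover have "card {C \<in> F. x \<notin> C} + card (occurrences x F)
      = card ({C \<in> F. x \<notin> C} \<union> occurrences x F)"
    using uhit_finite[OF assms] by (subst card_Un_disjoint) (auto simp: occurrences_def)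
  moreover have "{C \<in> F. x \<notin> C} \<union> occurrences x F = F"
    by (auto simp: occurrences_def)
  ultimately show ?thesis by simp
qed

lemma variables_iff: "v \<in> variables F \<longleftrightarrow> v \<ge> 0 \<and> (\<exists>C\<in>F. v \<in> C \<or> - v \<in> C)"
proof
  assume "v \<in> variables F"
  then obtain C y where "C \<in> F" "y \<in> C" "v = \<bar>y\<bar>"
    by (auto simp: variables_def)
  then show "v \<ge> 0 \<and> (\<exists>C\<in>F. v \<in> C \<or> - v \<in> C)"
    by (cases "y \<ge> 0") auto
next
  assume "v \<ge> 0 \<and> (\<exists>C\<in>F. v \<in> C \<or> - v \<in> C)"
  then show "v \<in> variables F"
    unfolding variables_def by (metis UnionI abs_minus_cancel abs_of_nonneg image_eqI)
qed

lemma uhit_variable_pos: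
  assumes "uhit F" "v \<in> variables F"
  shows "v > 0"
proof -
  have "0 \<notin> C" if "C \<in> F" for C
    using uhit_clause[OF assms(1) that] by (rule is_clause_zero)
  then show ?thesis
    using assms(2) by (auto simp: variables_iff less_le)
qed

lemma uhit_variable_occurs:
  assumes "uhit F" "v \<in> variables F" "\<bar>x\<bar> = v"
  shows "occurrences x F \<noteq> {}"
proof -
  have "x = v \<or> x = - v" using assms(3) by auto
  then obtain C where "C \<in> F" "x \<in> C \<or> - x \<in> C"
    using assms(2) unfolding variables_iff by (metis minus_minus)
  then show ?thesis
    using uhit_complement_occurs[OF assms(1), of C "- x"] by (auto simp: occurrences_def)
qed

section \<open>Variables of minimal degree and bounds on the deficiency\<close>

definition degree :: "literal \<Rightarrow> clause set \<Rightarrow> nat" where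
  "degree v F = card (occurrences v F \<union> occurrences (- v) F)"

lemma variables_set_true_min_degree:
  assumes F: "uhit F" and v: "v \<in> variables F"
    and min: "\<forall>w\<in>variables F. degree v F \<le> degree w F" and x: "\<bar>x\<bar> = v"
  shows "variables (set_true x F) = variables F - {v}"
proof
  have x': "x = v \<or> x = - v" using x by auto
  show "variables (set_true x F) \<subseteq> variables F - {v}"
    using x' uhit_variable_pos[OF F v] by (auto simp: variables_iff set_true_def)
  show "variables F - {v} \<subseteq> variables (set_true x F)"
  proof
    fix w assume w: "w \<in> variables F - {v}"
    have "\<not> occurrences w F \<union> occurrences (- w) F \<subseteq> occurrences x F"
    proof
      assume sub: "occurrences w F \<union> occurrences (- w) F \<subseteq> occurrences x F"
      have eq: "occurrences v F \<union> occurrences (- v) F = occurrences x F \<union> occurrences (- x) F"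
        using x' by auto
      \<comment> \<open>The complement \<open>- x\<close> occurs too, and its clause
        \<open>D\<close> makes the inclusion strict.\<close>
      obtain D where "D \<in> occurrences (- x) F"
        using uhit_variable_occurs[OF F v, of "- x"] x by auto
      then have "D \<notin> occurrences x F"
        using uhit_clause[OF F, of D] by (auto simp: occurrences_def dest: is_clause_uminus)
      with sub \<open>D \<in> _\<close> have "occurrences w F \<union> occurrences (- w) F
          \<subset> occurrences v F \<union> occurrences (- v) F"
        unfolding eq by blast
      then have "degree w F < degree v F"
        unfolding degree_def by (intro psubset_card_mono) (auto simp: finite_occurrences[OF F])
      with min w show False by (auto simp: not_le[symmetric])
    qed
    then obtain C where C: "C \<in> F" "x \<notin> C" "w \<in> C \<or> - w \<in> C"
      by (auto simp: occurrences_def)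
    have "w > 0" "v > 0" "w \<noteq> v"
      using uhit_variable_pos[OF F] w v by auto
    then have "w \<noteq> - x" "- w \<noteq> - x" using x' by auto
    then have "w \<in> C - {- x} \<or> - w \<in> C - {- x}" using C(3) by blast
    moreover have "C - {- x} \<in> set_true x F"
      using C by (auto simp: set_true_def)
    ultimately show "w \<in> variables (set_true x F)"
      unfolding variables_iff using \<open>w > 0\<close> by (meson Diff_iff less_imp_le)
  qed
qed

text \<open>The single lost variable accounts for the \<open>+ 1\<close>, the satisfied clauses for
  the subtracted cardinality.\<close>

lemma deficiency_set_true_min_degree:
  assumes F: "uhit F" and v: "v \<in> variables F"
    and min: "\<forall>w\<in>variables F. degree v F \<le> degree w F" and x: "\<bar>x\<bar> = v"
  shows "deficiency (set_true x F) = deficiency F + 1 - int (card (occurrences x F))"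
proof -
  have "finite (variables F)"
    using F finite_variables by (auto simp: uhit_def)
  then have "card (variables F) = Suc (card (variables F - {v}))"
    using v by (rule card.remove)
  then show ?thesis
    using card_set_true[OF F, of x]
    unfolding deficiency_def variables_set_true_min_degree[OF assms] by simp
qed

lemma ex_min_degree:
  assumes "variables F \<noteq> {}"
  obtains v where "v \<in> variables F" "\<forall>w\<in>variables F. degree v F \<le> degree w F"
  using ex_has_least_nat[of "\<lambda>v. v \<in> variables F" _ "\<lambda>v. degree v F"] assms by blast

text \<open>Induction on the number of variables: as \<open>v\<close> occurs, restriction does not
  increase the deficiency, so the lower bound passes from the restriction to
  \<open>F\<close>.\<close>

lemma uhit_deficiency_pos:
  assumes "uhit F"
  shows "deficiency F \<ge> 1"
  using assms
proof (induction "card (variables F)" arbitrary: F rule: less_induct)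
  case less
  have fin: "finite (variables F)"
    using less.prems finite_variables by (auto simp: uhit_def)
  show ?case
  proof (cases "variables F = {}")
    case True
    have "F \<noteq> {}"
      using uhit_ex[OF less.prems assignment_positive] by auto
    then have "card F > 0"
      using uhit_finite[OF less.prems] by (simp add: card_gt_0_iff)
    then show ?thesis by (simp add: deficiency_def True)
  next
    case False
    then obtain v where v: "v \<in> variables F"
        "\<forall>w\<in>variables F. degree v F \<le> degree w F"
      by (rule ex_min_degree)
    have pos: "v > 0" using uhit_variable_pos[OF less.prems v(1)] .
    then have abs: "\<bar>v\<bar> = v" by simp
    have "card (variables (set_true v F)) < card (variables F)"
      unfolding variables_set_true_min_degree[OF less.prems v abs]
      using fin v(1) by (rule card_Diff1_less)
    then have "deficiency (set_true v F) \<ge> 1"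
      using less.hyps uhit_set_true[OF less.prems, of v] pos by auto
    moreover have "card (occurrences v F) > 0"
      using uhit_variable_occurs[OF less.prems v(1) abs] finite_occurrences[OF less.prems]
      by (simp add: card_gt_0_iff)
    ultimately show ?thesis
      using deficiency_set_true_min_degree[OF less.prems v abs] by linarith
  qed
qed

lemma uhit_ex_variable_few_occurrences:
  assumes F: "uhit F" and ne: "variables F \<noteq> {}"
  obtains v where "v > 0" "occurrences v F \<noteq> {}" "occurrences (- v) F \<noteq> {}"
    "int (card (occurrences v F)) \<le> deficiency F"
    "int (card (occurrences (- v) F)) \<le> deficiency F"
proof -
  obtain v where v: "v \<in> variables F"
      "\<forall>w\<in>variables F. degree v F \<le> degree w F"
    using ne by (rule ex_min_degree)
  have pos: "v > 0" using uhit_variable_pos[OF F v(1)] .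
  \<comment> \<open>The restriction has deficiency at least 1, which turns the formula for its
    deficiency into an upper bound on the occurrences of \<open>x\<close>.\<close>
  have "int (card (occurrences x F)) \<le> deficiency F" if "\<bar>x\<bar> = v" for x
    using deficiency_set_true_min_degree[OF F v that]
      uhit_deficiency_pos[OF uhit_set_true[OF F, of x]] that pos by auto
  then show thesis
    using that[of v] pos uhit_variable_occurs[OF F v(1)] by auto
qed

section \<open>Clause-factors\<close>

text \<open>An assignment is moved into the subcube of \<open>\<Inter>G\<close>, which lies in that
  of \<open>E\<close>; a clause \<open>D\<close> falsified there has its reduced clause falsified by
  the original assignment. Applications can thus name \<open>E\<close> instead of computing the
  intersection.\<close>

lemma clause_factorI:
  assumes G: "is_clause_set G" "G \<noteq> {}" and E: "\<And>D. D \<in> G \<Longrightarrow> E \<subseteq> D"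
    and cover: "\<And>T. assignment T \<Longrightarrow> E \<subseteq> T \<Longrightarrow> \<exists>D\<in>G. D \<subseteq> T"
  shows "clause_factor G"
proof -
  have cs: "is_clause_set ((\<lambda>D. D - \<Inter>G) ` G)"
    using G by (auto simp: is_clause_set_def intro: is_clause_subset)
  have cl: "is_clause (\<Inter>G)"
    using G by (metis Inf_lower all_not_in_conv is_clause_set_def is_clause_subset)
  have "unsatisfiable ((\<lambda>D. D - \<Inter>G) ` G)"
    unfolding unsatisfiable_iff[OF cs]
  proof (intro allI impI)
    fix T assume "assignment T"
    then have "assignment (override T (\<Inter>G))"
      using cl by (rule assignment_override)
    moreover have "E \<subseteq> override T (\<Inter>G)"
      using E subset_override by blast
    ultimately obtain D where "D \<in> G" "D \<subseteq> override T (\<Inter>G)"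
      using cover by blast
    moreover from this have "D - \<Inter>G \<subseteq> T"
      by (auto simp only: override_def)
    ultimately show "\<exists>C\<in>(\<lambda>D. D - \<Inter>G) ` G. C \<subseteq> T"
      by (intro bexI[OF _ imageI])
  qed
  then show ?thesis using G by (simp add: clause_factor_def)
qed

lemma clause_irreducible_factor:
  assumes "clause_irreducible F" "G \<subseteq> F" "clause_factor G"
  shows "card G = 1 \<or> G = F"
  using assms
  by (auto simp: clause_irreducible_def clause_factor_of_def trivial_clause_factor_of_def)

text \<open>The two clauses cover the subcube of \<open>C\<close>, so they form a two-element
  clause-factor, which irreducibility allows only as all of \<open>F\<close>.\<close>

lemma clause_irreducible_complementary_pair:
  assumes F: "clause_irreducible F" and x: "insert x C \<in> F" "insert (- x) C \<in> F" "x \<notin> C" "- x \<notin> C"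
  shows "F = {insert x C, insert (- x) C}"
proof -
  let ?G = "{insert x C, insert (- x) C}"
  have cs: "is_clause_set F" using F by (simp add: clause_irreducible_def)
  then have "is_clause (insert x C)" using x(1) by (simp add: is_clause_set_def)
  then have x0: "x \<noteq> 0" by (auto dest: is_clause_zero)
  have "clause_factor ?G"
  proof (rule clause_factorI[where E = C])
    show "is_clause_set ?G" using cs x by (auto simp: is_clause_set_def)
    show "\<exists>D\<in>?G. D \<subseteq> T" if "assignment T" "C \<subseteq> T" for T
      using that assignment_uminus[OF that(1) x0] by auto
  qed auto
  moreover have "insert x C \<noteq> insert (- x) C"
    using x x0 by auto
  ultimately show ?thesis
    using clause_irreducible_factor[OF F, of ?G] x by auto
qed

text \<open>Crossing the variable of \<open>x\<close> from the subcube of \<open>D\<close> leads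
  into a clause containing \<open>x\<close>, and \<open>C\<close> is the only one.\<close>

lemma clause_subset_of_single_occurrence:
  assumes F: "uhit F" and C: "occurrences x F = {C}" and D: "D \<in> occurrences (- x) F"
  shows "C - {x} \<subseteq> D - {- x}"
proof -
  have CF: "C \<in> F" "x \<in> C" and DF: "D \<in> F" "- x \<in> D"
    using C D by (auto simp: occurrences_def)
  note cl = uhit_clause[OF F CF(1)] uhit_clause[OF F DF(1)]
  show ?thesis
  proof (rule clause_subset_if_implied)
    show "is_clause (D - {- x})" using cl(2) by (rule is_clause_subset) auto
    show "0 \<notin> C - {x}" using cl(1) by (auto dest: is_clause_zero)
    fix T assume T: "assignment T" "D - {- x} \<subseteq> T"
    from uhit_flip_literal[OF F DF T] obtain C' where "C' \<in> F" "x \<in> C'" "C' - {x} \<subseteq> T"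
      by auto
    moreover from this have "C' = C"
      using C by (auto simp: occurrences_def)
    ultimately show "C - {x} \<subseteq> T" by simp
  qed
qed

lemma clause_irreducible_single_occurrence:
  assumes F: "uhit F" and irr: "clause_irreducible F" and C: "occurrences x F = {C}"
  shows "card F = 2"
proof -
  have CF: "C \<in> F" "x \<in> C" using C by (auto simp: occurrences_def)
  have cl: "is_clause C" by (rule uhit_clause[OF F CF(1)])
  have x: "x \<noteq> 0" "- x \<notin> C" using cl CF(2) by (auto simp: is_clause_def)
  let ?G = "occurrences (- x) F"
  obtain D where D: "D \<in> ?G"
    using uhit_complement_occurs[OF F CF] by (auto simp: occurrences_def)
  have "clause_factor ?G"
  \<comment> \<open>\<open>E\<close> is the mirror image of \<open>C\<close> in the variable of
    \<open>x\<close>: crossing from the subcube of \<open>C\<close> always ends in a clause of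
    \<open>?G\<close>.\<close>
  proof (rule clause_factorI[where E = "insert (- x) (C - {x})"])
    show "is_clause_set ?G"
      using F by (auto simp: occurrences_def uhit_def is_clause_set_def)
    show "?G \<noteq> {}" using D by auto
    show "insert (- x) (C - {x}) \<subseteq> D" if "D \<in> ?G" for D
      using clause_subset_of_single_occurrence[OF F C that] that by (auto simp: occurrences_def)
    fix T assume T: "assignment T" "insert (- x) (C - {x}) \<subseteq> T"
    then have "C - {x} \<subseteq> T" by blast
    from uhit_flip_literal[OF F CF T(1) this] obtain D where
      "D \<in> F" "- x \<in> D" "D - {- x} \<subseteq> T" .
    then show "\<exists>D\<in>?G. D \<subseteq> T"
      using T(2) by (auto simp: occurrences_def)
  qed
  moreover have "?G \<subseteq> F" "?G \<noteq> F"
    using CF x(2) by (auto simp: occurrences_def)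
  ultimately have "card ?G = 1"
    using clause_irreducible_factor[OF irr] by blast
  then have G: "?G = {D}"
    using D by (auto simp: card_1_singleton_iff)
  have DF: "D \<in> F" "- x \<in> D" using D by (auto simp: occurrences_def)
  \<comment> \<open>Now \<open>D\<close> is the only clause with \<open>- x\<close>, so the
    inclusion also holds with the signs exchanged.\<close>
  have "D - {- x} \<subseteq> C - {x}"
    using clause_subset_of_single_occurrence[OF F G] C by simp
  then have eq: "D - {- x} = C - {x}"
    using clause_subset_of_single_occurrence[OF F C D] by blast
  have "insert x (C - {x}) = C"
    using CF by auto
  moreover have "insert (- x) (C - {x}) = D"
    unfolding eq[symmetric] using DF by auto
  ultimately have "F = {C, D}"
    using clause_irreducible_complementary_pair[OF irr, of x "C - {x}"] CF DF x by auto
  moreover have "C \<noteq> D" using DF x by auto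
  ultimately show ?thesis by simp
qed

section \<open>Two partitions of a set into two subcubes\<close>

text \<open>The subcube of \<open>P1\<close> is a proper part of that of \<open>Q1\<close>, and the
  rest of \<open>Q1\<close> lies in \<open>P2\<close>. This makes \<open>P1\<close> one half of
  \<open>Q1\<close>, and likewise \<open>Q2\<close> one half of \<open>P2\<close>: the configuration
  of an nfs-flip.\<close>

lemma two_cubes_strict:
  assumes cl: "is_clause P1" "is_clause P2" "is_clause Q1" "is_clause Q2"
    and P: "\<exists>x\<in>P1. - x \<in> P2" and Q: "\<exists>x\<in>Q1. - x \<in> Q2"
    and cover: "\<And>T. assignment T \<Longrightarrow> P1 \<subseteq> T \<or> P2 \<subseteq> T \<longleftrightarrow> Q1 \<subseteq> T \<or> Q2 \<subseteq> T"
    and less: "Q1 \<subset> P1"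
  obtains E x y where "nfs_data E x y"
    "{P1, P2} = nfs_pair E x y" "{Q1, Q2} = nfs_flipped_pair E x y"
proof -
  note zero = cl[THEN is_clause_zero]
  have P2_sub: "P2 \<subseteq> insert (- a) Q1" if a: "a \<in> P1 - Q1" for a
  proof (rule clause_subset_if_implied)
    have a0: "a \<noteq> 0" using a zero by auto
    show "is_clause (insert (- a) Q1)"
      using cl(3) a a0 by (intro is_clause_insert) auto
    fix T assume T: "assignment T" "insert (- a) Q1 \<subseteq> T"
    then have "\<not> P1 \<subseteq> T"
      using a assignment_uminus[OF T(1) a0] by auto
    then show "P2 \<subseteq> T" using cover[OF T(1)] T(2) by auto
  qed (rule zero)
  obtain a where a: "a \<in> P1 - Q1" using less by blast
  obtain c where c: "c \<in> P1" "- c \<in> P2" using P by blast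
  have cQ: "- c \<notin> Q1" using is_clause_uminus[OF cl(1) c(1)] less by auto
  \<comment> \<open>By \<open>P2_sub\<close>, the literal \<open>- c\<close> of \<open>P2\<close> is
    \<open>- a'\<close> or lies in \<open>Q1\<close>; the latter is excluded, so \<open>P1\<close>
    exceeds \<open>Q1\<close> by one literal only.\<close>
  have "a' = c" if "a' \<in> P1 - Q1" for a'
    using P2_sub[OF that] c(2) cQ by auto
  with a have P1: "P1 = insert a Q1" and aP2: "- a \<in> P2" "- a \<notin> Q1"
    using less c(2) cQ by blast+
  have a0: "a \<noteq> 0" using a zero by auto

  \<comment> \<open>Otherwise \<open>P1\<close> and \<open>P2\<close> would be the two halves of
    \<open>Q1\<close>, leaving no room for the disjoint subcube of \<open>Q2\<close>.\<close>
  have "P2 \<noteq> insert (- a) Q1"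
  proof
    assume eq: "P2 = insert (- a) Q1"
    obtain T where T: "assignment T" "Q2 \<subseteq> T" using assignment_extending[OF cl(4)] .
    then have "Q1 \<subseteq> T" using cover[OF T(1)] eq P1 by auto
    with Q T show False using zero assignment_uminus[OF T(1)] by (metis in_mono)
  qed
  then obtain b0 where b0: "b0 \<in> Q1 - P2"
    using P2_sub[OF a] aP2 by blast
  have Q2_sub: "Q2 \<subseteq> insert (- b) P2" if b: "b \<in> Q1 - P2" for b
  proof (rule clause_subset_if_implied)
    have b0: "b \<noteq> 0" using b zero by auto
    show "is_clause (insert (- b) P2)"
      using cl(2) b b0 by (intro is_clause_insert) auto
    fix T assume T: "assignment T" "insert (- b) P2 \<subseteq> T"
    then have "\<not> Q1 \<subseteq> T"
      using b assignment_uminus[OF T(1) b0] by auto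
    then show "Q2 \<subseteq> T" using cover[OF T(1)] T(2) by auto
  qed (rule zero)
  obtain b where b: "b \<in> Q1" "- b \<in> Q2" using Q by blast
  have "- b \<notin> Q1" using is_clause_uminus[OF cl(3) b(1)] .
  moreover have "b \<noteq> a" using a b by auto
  ultimately have bP2: "- b \<notin> P2" using P2_sub[OF a] by auto
  have uniq: "b' = b" if "b' \<in> Q1 - P2" for b'
    using Q2_sub[OF that] b(2) bP2 by auto
  with b0 have bP: "b \<notin> P2" by auto

  define E where "E = Q1 - {b}"
  have Q1: "Q1 = insert b E" using b by (auto simp: E_def)
  have P2: "P2 = insert (- a) E"
    using P2_sub[OF a] uniq aP2 bP unfolding E_def by blast
  have "P2 \<subseteq> Q2"
  proof (rule clause_subset_if_implied[OF cl(4) zero(2)])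
    fix T assume T: "assignment T" "Q2 \<subseteq> T"
    then have "b \<notin> T" using b zero assignment_uminus[OF T(1), of b] by auto
    then show "P2 \<subseteq> T" using cover[OF T(1)] T(2) P1 b by auto
  qed
  then have Q2: "Q2 = insert (- b) P2" using Q2_sub b bP by auto
  \<comment> \<open>The sign is negative because \<open>P2\<close>, the shorter clause of the
    nfs-pair, is \<open>E\<close> with \<open>- a\<close> added.\<close>
  have "nfs_data E (- a) b"
    unfolding nfs_data_def
  proof (intro conjI)
    show "is_clause E" unfolding E_def using cl(3) by (rule is_clause_subset) auto
    show "\<bar>- a\<bar> \<noteq> \<bar>b\<bar>"
      using \<open>b \<noteq> a\<close> aP2(2) b(1) by (auto simp: abs_eq_iff)
  qed (use a a0 aP2 b zero \<open>- b \<notin> Q1\<close> in \<open>auto simp: E_def\<close>)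
  then show thesis
    by (rule that) (auto simp: nfs_pair_def nfs_flipped_pair_def P1 Q1 P2 Q2)
qed

lemma nfs_data_commute: "nfs_data E x y \<Longrightarrow> nfs_data E y x"
  by (auto simp: nfs_data_def)

lemma nfs_flipped_pair_eq: "nfs_flipped_pair E x y = nfs_pair E y x"
  by (auto simp: nfs_pair_def nfs_flipped_pair_def)

lemma nfs_pair_flipped_disjoint:
  assumes "nfs_data E x y"
  shows "nfs_pair E x y \<inter> nfs_flipped_pair E x y = {}"
proof -
  have "- y \<notin> C \<and> (x \<in> C \<or> - x \<in> C)" if "C \<in> nfs_pair E x y" for C
    using that assms by (auto simp: nfs_pair_def nfs_data_def)
  moreover have "- y \<in> C \<or> (x \<notin> C \<and> - x \<notin> C)" if "C \<in> nfs_flipped_pair E x y" for C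
    using that assms by (auto simp: nfs_flipped_pair_def nfs_data_def)
  ultimately show ?thesis by blast
qed

text \<open>If \<open>P\<close> decided the sign of \<open>y\<close>, its subcube would lie in that
  of \<open>Q1\<close> or of \<open>Q2\<close>. So \<open>y\<close> cuts it into two halves, one
  inside each.\<close>

lemma cube_split:
  assumes cl: "is_clause P" "is_clause Q1" "is_clause Q2"
    and y: "y \<in> Q1" "- y \<in> Q2"
    and cover: "\<And>T. assignment T \<Longrightarrow> P \<subseteq> T \<Longrightarrow> Q1 \<subseteq> T \<or> Q2 \<subseteq> T"
    and nsub: "\<not> Q1 \<subseteq> P" "\<not> Q2 \<subseteq> P"
  shows "y \<notin> P" "- y \<notin> P" "Q1 - {y} \<subseteq> P" "Q2 - {- y} \<subseteq> P"
proof -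
  note zero = cl[THEN is_clause_zero]
  have y0: "y \<noteq> 0" using y zero by auto
  have left: "Q1 \<subseteq> insert y P" if "- y \<notin> P"
  proof (rule clause_subset_if_implied[OF _ zero(2)])
    show "is_clause (insert y P)"
      using cl(1) y0 that by (rule is_clause_insert)
    fix T assume T: "assignment T" "insert y P \<subseteq> T"
    then have "\<not> Q2 \<subseteq> T" using assignment_uminus[OF T(1) y0] y by auto
    then show "Q1 \<subseteq> T" using cover[OF T(1)] T(2) by auto
  qed
  have right: "Q2 \<subseteq> insert (- y) P" if "y \<notin> P"
  proof (rule clause_subset_if_implied[OF _ zero(3)])
    show "is_clause (insert (- y) P)"
      using cl(1) y0 that by (intro is_clause_insert) auto
    fix T assume T: "assignment T" "insert (- y) P \<subseteq> T"
    then have "\<not> Q1 \<subseteq> T" using assignment_uminus[OF T(1) y0] y by auto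
    then show "Q2 \<subseteq> T" using cover[OF T(1)] T(2) by auto
  qed
  show 1: "y \<notin> P" using left nsub(1) is_clause_uminus[OF cl(1)] by auto
  show 2: "- y \<notin> P" using right nsub(2) is_clause_uminus[OF cl(1)] by auto
  show "Q1 - {y} \<subseteq> P" "Q2 - {- y} \<subseteq> P" using left[OF 2] right[OF 1] by auto
qed

text \<open>By \<open>cube_split\<close>, \<open>y\<close> halves \<open>P1\<close> and
  \<open>P2\<close>, and \<open>x\<close> halves \<open>Q1\<close>. Hence \<open>P1\<close> and
  \<open>P2\<close> both consist of the core \<open>Q1 - {y}\<close> and one literal on the variable
  of \<open>x\<close>.\<close>

lemma two_cubes_incomparable:
  assumes cl: "is_clause P1" "is_clause P2" "is_clause Q1" "is_clause Q2"
    and P: "\<exists>x\<in>P1. - x \<in> P2" and Q: "\<exists>x\<in>Q1. - x \<in> Q2"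
    and cover: "\<And>T. assignment T \<Longrightarrow> P1 \<subseteq> T \<or> P2 \<subseteq> T \<longleftrightarrow> Q1 \<subseteq> T \<or> Q2 \<subseteq> T"
    and nsub: "\<And>A B. A \<in> {P1, P2} \<Longrightarrow> B \<in> {Q1, Q2} \<Longrightarrow> \<not> A \<subseteq> B \<and> \<not> B \<subseteq> A"
  obtains E x where "x \<notin> E" "- x \<notin> E" "P1 = insert x E" "P2 = insert (- x) E"
proof -
  obtain x where x: "x \<in> P1" "- x \<in> P2" using P by blast
  obtain y where y: "y \<in> Q1" "- y \<in> Q2" using Q by blast
  note p1 = cube_split[OF cl(1,3,4) y] and p2 = cube_split[OF cl(2,3,4) y]
  note q1 = cube_split[OF cl(3,1,2) x]
  have 1: "y \<notin> P1" "Q1 - {y} \<subseteq> P1"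
    by (rule p1; use cover nsub in auto)+
  have 2: "y \<notin> P2" "Q1 - {y} \<subseteq> P2"
    by (rule p2; use cover nsub in auto)+
  have 3: "x \<notin> Q1" "- x \<notin> Q1" "P1 - {x} \<subseteq> Q1" "P2 - {- x} \<subseteq> Q1"
    by (rule q1; use cover nsub in auto)+
  show thesis
  proof (rule that[of x "Q1 - {y}"])
    show "P1 = insert x (Q1 - {y})" using 1 3 x by blast
    show "P2 = insert (- x) (Q1 - {y})" using 2 3 x by blast
  qed (use 3 in auto)
qed

text \<open>The cases come from comparing a subcube of each decomposition: equality gives
  \<open>common\<close>, strict inclusion either way gives \<open>flip\<close>, and incomparability
  throughout gives \<open>merge\<close>.\<close>

lemma two_cubes:
  assumes cl: "is_clause P1" "is_clause P2" "is_clause Q1" "is_clause Q2"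
    and P: "\<exists>x\<in>P1. - x \<in> P2" and Q: "\<exists>x\<in>Q1. - x \<in> Q2"
    and "\<forall>T. assignment T \<longrightarrow> (P1 \<subseteq> T \<or> P2 \<subseteq> T \<longleftrightarrow> Q1 \<subseteq> T \<or> Q2 \<subseteq> T)"
  obtains (common) "{P1, P2} \<inter> {Q1, Q2} \<noteq> {}"
  | (merge) E x where "x \<notin> E" "- x \<notin> E" "P1 = insert x E" "P2 = insert (- x) E"
  | (flip) E x y where "nfs_data E x y"
    "{P1, P2} = nfs_pair E x y" "{Q1, Q2} = nfs_flipped_pair E x y"
proof -
  have cover: "P1 \<subseteq> T \<or> P2 \<subseteq> T \<longleftrightarrow> Q1 \<subseteq> T \<or> Q2 \<subseteq> T" if "assignment T" for T
    using assms(7) that by blast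
  have P': "\<exists>x\<in>P2. - x \<in> P1" and Q': "\<exists>x\<in>Q2. - x \<in> Q1"
    using P Q by (metis minus_minus)+
  have refine: thesis if AB: "{A, A'} = {P1, P2}" "{B, B'} = {Q1, Q2}" "B \<subset> A" for A A' B B'
  proof (rule two_cubes_strict[of A A' B B'])
    show "\<exists>x\<in>A. - x \<in> A'" "\<exists>x\<in>B. - x \<in> B'"
      using AB(1,2) P P' Q Q' by (auto simp: doubleton_eq_iff)
    show "A \<subseteq> T \<or> A' \<subseteq> T \<longleftrightarrow> B \<subseteq> T \<or> B' \<subseteq> T" if "assignment T" for T
      using AB(1,2) cover[OF that] by (auto simp: doubleton_eq_iff)
  qed (use AB cl flip in \<open>auto simp: doubleton_eq_iff\<close>)
  have coarsen: thesis if AB: "{A, A'} = {P1, P2}" "{B, B'} = {Q1, Q2}" "A \<subset> B" for A A' B B'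
  proof (rule two_cubes_strict[of B B' A A'])
    show "\<exists>x\<in>A. - x \<in> A'" "\<exists>x\<in>B. - x \<in> B'"
      using AB(1,2) P P' Q Q' by (auto simp: doubleton_eq_iff)
    show "B \<subseteq> T \<or> B' \<subseteq> T \<longleftrightarrow> A \<subseteq> T \<or> A' \<subseteq> T" if "assignment T" for T
      using AB(1,2) cover[OF that] by (auto simp: doubleton_eq_iff)
    \<comment> \<open>Here the \<open>Q\<close> side is the nfs-pair; exchanging \<open>x\<close>
      and \<open>y\<close> makes the \<open>P\<close> side the nfs-pair.\<close>
    show thesis if "nfs_data E x y" "{B, B'} = nfs_pair E x y" "{A, A'} = nfs_flipped_pair E x y"
      for E x y
      using flip[OF nfs_data_commute[OF that(1)]] that(2,3) AB(1,2)
      by (simp add: nfs_flipped_pair_eq)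
  qed (use AB cl in \<open>auto simp: doubleton_eq_iff\<close>)
  show thesis
  proof (cases "\<exists>A\<in>{P1, P2}. \<exists>B\<in>{Q1, Q2}. A \<subseteq> B \<or> B \<subseteq> A")
    case True
    then obtain A B where AB: "A \<in> {P1, P2}" "B \<in> {Q1, Q2}" "A \<subseteq> B \<or> B \<subseteq> A" by blast
    then obtain A' B' where AB': "{A, A'} = {P1, P2}" "{B, B'} = {Q1, Q2}" by blast
    consider "A = B" | "A \<subset> B" | "B \<subset> A" using AB(3) by blast
    then show thesis
      by cases (use AB common refine[OF AB'] coarsen[OF AB'] in blast)+
  next
    case False
    show thesis
    proof (rule two_cubes_incomparable[OF cl P Q])
      show "P1 \<subseteq> T \<or> P2 \<subseteq> T \<longleftrightarrow> Q1 \<subseteq> T \<or> Q2 \<subseteq> T" if "assignment T" for T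
        using that by (rule cover)
      show "\<not> A \<subseteq> B \<and> \<not> B \<subseteq> A" if "A \<in> {P1, P2}" "B \<in> {Q1, Q2}" for A B
        using False that by blast
    qed (rule merge)
  qed
qed

section \<open>Deficiency 2\<close>

lemma uhit_flip_to_reducible:
  assumes F: "uhit F"
    and A: "occurrences x F = {A1, A2}" "A1 \<noteq> A2"
    and B: "occurrences (- x) F = {B1, B2}" "B1 \<noteq> B2"
    and irr: "clause_irreducible F"
  shows "\<exists>G. nfs_flip F G \<and> clause_reducible G"
proof -
  have mem: "A1 \<in> F" "A2 \<in> F" "B1 \<in> F" "B2 \<in> F" "x \<in> A1" "x \<in> A2" "- x \<in> B1" "- x \<in> B2"
    using A B by (auto simp: occurrences_def)
  note cl = mem(1-4)[THEN uhit_clause[OF F]]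
  have nx: "- x \<notin> A1" "- x \<notin> A2" "x \<notin> B1" "x \<notin> B2"
    using is_clause_uminus[OF cl(1) mem(5)] is_clause_uminus[OF cl(2) mem(6)]
      is_clause_uminus[OF cl(3) mem(7)] is_clause_uminus[OF cl(4) mem(8)] by simp_all
  have x0: "x \<noteq> 0" using is_clause_zero[OF cl(1)] mem(5) by auto
  have neAB: "A1 \<noteq> B1" "A1 \<noteq> B2" "A2 \<noteq> B1" "A2 \<noteq> B2"
    using mem nx by auto
  define P1 P2 Q1 Q2 where "P1 = A1 - {x}" "P2 = A2 - {x}" "Q1 = B1 - {- x}" "Q2 = B2 - {- x}"
  note defs = this
  have ins: "insert x P1 = A1" "insert x P2 = A2" "insert (- x) Q1 = B1" "insert (- x) Q2 = B2"
    and notin: "x \<notin> P1" "- x \<notin> P1" "x \<notin> P2" "- x \<notin> P2" "x \<notin> Q1" "- x \<notin> Q1" "x \<notin> Q2" "- x \<notin> Q2"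
    using mem nx by (auto simp: defs)
  have clP: "is_clause P1" "is_clause P2" "is_clause Q1" "is_clause Q2"
    unfolding defs using cl by (auto intro: is_clause_subset)
  have P: "\<exists>y\<in>P1. - y \<in> P2"
    using hitting_off_literal[OF F mem(1,2), of "- x"] nx A(2) by (auto simp: defs)
  have Q: "\<exists>y\<in>Q1. - y \<in> Q2"
    using hitting_off_literal[OF F mem(3,4), of x] nx B(2) by (auto simp: defs)
  \<comment> \<open>Crossing the variable of \<open>x\<close> in either direction shows that both
    pairs cover the same assignments.\<close>
  have "P1 \<subseteq> T \<or> P2 \<subseteq> T \<longleftrightarrow> Q1 \<subseteq> T \<or> Q2 \<subseteq> T" if T: "assignment T" for T
  proof
    assume "P1 \<subseteq> T \<or> P2 \<subseteq> T"
    then obtain C where C: "C \<in> F" "x \<in> C" "C - {x} \<subseteq> T"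
      using mem by (auto simp: defs)
    obtain D where "D \<in> F" "- x \<in> D" "D - {- x} \<subseteq> T"
      using uhit_flip_literal[OF F C(1,2) T C(3)] .
    moreover from this have "D = B1 \<or> D = B2" using B(1) by (auto simp: occurrences_def)
    ultimately show "Q1 \<subseteq> T \<or> Q2 \<subseteq> T" by (auto simp: defs)
  next
    assume "Q1 \<subseteq> T \<or> Q2 \<subseteq> T"
    then obtain C where C: "C \<in> F" "- x \<in> C" "C - {- x} \<subseteq> T"
      using mem by (auto simp: defs)
    obtain D where "D \<in> F" "x \<in> D" "D - {x} \<subseteq> T"
      using uhit_flip_literal[OF F C(1,2) T C(3)] by auto
    moreover from this have "D = A1 \<or> D = A2" using A(1) by (auto simp: occurrences_def)
    ultimately show "P1 \<subseteq> T \<or> P2 \<subseteq> T" by (auto simp: defs)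
  qed
  then have cover: "\<forall>T. assignment T \<longrightarrow> (P1 \<subseteq> T \<or> P2 \<subseteq> T \<longleftrightarrow> Q1 \<subseteq> T \<or> Q2 \<subseteq> T)"
    by blast
  show ?thesis
  proof (cases rule: two_cubes[OF clP P Q cover, case_names common merge flip])
    \<comment> \<open>A shared \<open>C\<close> occurs with both signs of \<open>x\<close>, which
      leaves \<open>F\<close> only two clauses, against the three distinct clauses
      \<open>A1\<close>, \<open>A2\<close>, \<open>B1\<close>.\<close>
    case common
    then obtain C where C: "C \<in> {P1, P2}" "C \<in> {Q1, Q2}" by blast
    then have "insert x C \<in> {A1, A2}" "insert (- x) C \<in> {B1, B2}" "x \<notin> C" "- x \<notin> C"
      using ins notin by auto
    then have "F = {insert x C, insert (- x) C}"
      using mem by (intro clause_irreducible_complementary_pair[OF irr]) auto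
    then have "card {A1, A2, B1} \<le> card {insert x C, insert (- x) C}"
      using mem by (intro card_mono) auto
    then show ?thesis using neAB A(2) by (auto simp: card_insert_if split: if_splits)
  next
    \<comment> \<open>Now \<open>A1\<close> and \<open>A2\<close> differ only in the sign of
      \<open>y\<close>, so they would be all of \<open>F\<close>, excluding
      \<open>B1\<close>.\<close>
    case (merge E y)
    have "y \<noteq> x" "y \<noteq> - x" using merge notin by auto
    moreover have "A1 = insert y (insert x E)" "A2 = insert (- y) (insert x E)"
      using merge ins by auto
    ultimately have "F = {A1, A2}"
      using clause_irreducible_complementary_pair[OF irr, of y "insert x E"] mem merge by auto
    then show ?thesis using mem neAB by auto
  next
    case (flip E a b)
    \<comment> \<open>Only the clauses with \<open>x\<close> are flipped, so \<open>x\<close> joins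
      the core; those with \<open>- x\<close> stay.\<close>
    let ?E = "insert x E"
    have nE: "x \<notin> E" "- x \<notin> E" "x \<noteq> a" "x \<noteq> - a" "x \<noteq> b" "x \<noteq> - b"
    proof -
      have "P1 \<union> P2 = E \<union> {a, - a, b}"
        using arg_cong[OF flip(2), of Union] by (auto simp: nfs_pair_def)
      moreover have "Q1 \<union> Q2 = E \<union> {a, b, - b}"
        using arg_cong[OF flip(3), of Union] by (auto simp: nfs_flipped_pair_def)
      ultimately show "x \<notin> E" "- x \<notin> E" "x \<noteq> a" "x \<noteq> - a" "x \<noteq> b" "x \<noteq> - b"
        using notin by blast+
    qed
    have ab: "a \<notin> E" "- a \<notin> E" "b \<notin> E" "- b \<notin> E" "a \<noteq> b" "a \<noteq> - b" "a \<noteq> 0" "b \<noteq> 0"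
      and clE: "is_clause E"
      using flip(1) by (auto simp: nfs_data_def)
    have data: "nfs_data ?E a b"
      using flip(1) nE x0 by (auto simp: nfs_data_def intro!: is_clause_insert)
    have pA: "nfs_pair ?E a b = {A1, A2}"
      using arg_cong[OF flip(2), of "(`) (insert x)"] ins by (auto simp: nfs_pair_def insert_commute)
    have pB: "{insert (- x) (insert a (insert (- b) E)), insert (- x) (insert b E)} = {B1, B2}"
      using arg_cong[OF flip(3), of "(`) (insert (- x))"] ins
      by (auto simp: nfs_flipped_pair_def insert_commute)
    \<comment> \<open>The flip creates \<open>insert x ?C\<close>, while
      \<open>insert (- x) ?C\<close> is already \<open>B1\<close> or \<open>B2\<close>: the
      complementary pair that makes \<open>G\<close> reducible.\<close>
    let ?C = "insert a (insert (- b) E)"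
    \<comment> \<open>A flip clause in \<open>F\<close> contains \<open>x\<close>, so it would be
      \<open>A1\<close> or \<open>A2\<close> and belong to the nfs-pair.\<close>
    have disj: "nfs_flipped_pair ?E a b \<inter> F = {}"
    proof -
      have "D \<notin> F" if "D \<in> nfs_flipped_pair ?E a b" for D
      proof
        assume "D \<in> F"
        moreover have "x \<in> D" using that by (auto simp: nfs_flipped_pair_def)
        ultimately have "D \<in> nfs_pair ?E a b" using A(1) pA by (auto simp: occurrences_def)
        with that nfs_pair_flipped_disjoint[OF data] show False by blast
      qed
      then show ?thesis by blast
    qed
    define G where "G = (F - nfs_pair ?E a b) \<union> nfs_flipped_pair ?E a b"
    have "nfs_flip F G"
      unfolding nfs_flip_def
    proof (intro exI conjI)
      show "nfs_pair ?E a b \<subseteq> F" unfolding pA using mem by simp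
    qed (rule data disj G_def)+
    moreover have "clause_reducible G"
      unfolding clause_reducible_def
    proof
      have "is_clause (insert x (insert b E))" "is_clause (insert x ?C)"
        using ab clE nE x0 by (auto intro!: is_clause_insert)
      then show "is_clause_set G"
        using F by (simp add: G_def uhit_def is_clause_set_def nfs_flipped_pair_def insert_commute)
      show "\<not> clause_irreducible G"
      proof
        assume irrG: "clause_irreducible G"
        have "insert x ?C \<in> G" and third: "insert x (insert b E) \<in> G"
          by (simp_all add: G_def nfs_flipped_pair_def insert_commute)
        moreover have "insert (- x) ?C \<in> {B1, B2}" unfolding pB[symmetric] by simp
        then have "insert (- x) ?C \<in> G"
          unfolding G_def pA using mem neAB by blast
        moreover have "x \<notin> ?C" "- x \<notin> ?C" using nE by auto
        ultimately have "G = {insert x ?C, insert (- x) ?C}"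
          by (intro clause_irreducible_complementary_pair[OF irrG])
        \<comment> \<open>The other flip clause lacks \<open>a\<close>, so the complementary pair is
          not all of \<open>G\<close>.\<close>
        with third have "insert x (insert b E) \<in> {insert x ?C, insert (- x) ?C}" by blast
        moreover have "a \<notin> insert x (insert b E)" using ab nE by auto
        ultimately show False by blast
      qed
    qed
    ultimately show ?thesis by blast
  qed
qed

lemma clause_irreducible_deficiency_2:
  assumes F: "uhit F" and irr: "clause_irreducible F" and def: "deficiency F = 2"
  shows "\<exists>G. nfs_flip F G \<and> clause_reducible G"
proof -
  have fin: "finite (variables F)" using F finite_variables by (auto simp: uhit_def)
  have "variables F \<noteq> {}"
  proof
    assume empty: "variables F = {}"
    then have "F \<subseteq> {{}}" by (auto simp: variables_def)
    then have "card F \<le> card {{} :: clause}" by (intro card_mono) auto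
    with empty def show False by (simp add: deficiency_def)
  qed
  then have "card (variables F) > 0" using fin by (simp add: card_gt_0_iff)
  \<comment> \<open>With at least one variable, deficiency 2 forces at least three clauses; this
    rules out literals occurring only once.\<close>
  with def have card: "card F \<noteq> 2" by (auto simp: deficiency_def)
  obtain v where v: "occurrences v F \<noteq> {}" "occurrences (- v) F \<noteq> {}"
      "card (occurrences v F) \<le> 2" "card (occurrences (- v) F) \<le> 2"
    using uhit_ex_variable_few_occurrences[OF F \<open>variables F \<noteq> {}\<close>] def
    by (metis of_nat_le_iff of_nat_numeral)
  have two: "card (occurrences x F) = 2"
    if "occurrences x F \<noteq> {}" "card (occurrences x F) \<le> 2" for x
  proof -
    have "card (occurrences x F) \<noteq> 1"
      using clause_irreducible_single_occurrence[OF F irr] card by (auto simp: card_1_singleton_iff)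
    moreover have "card (occurrences x F) \<noteq> 0"
      using that finite_occurrences[OF F] by simp
    ultimately show ?thesis using that(2) by linarith
  qed
  obtain A1 A2 where A: "occurrences v F = {A1, A2}" "A1 \<noteq> A2"
    using two[OF v(1,3)] by (auto simp: card_2_iff)
  obtain B1 B2 where B: "occurrences (- v) F = {B1, B2}" "B1 \<noteq> B2"
    using two[OF v(2,4)] by (auto simp: card_2_iff)
  show ?thesis by (rule uhit_flip_to_reducible[OF F A B irr])
qed

theorem lemma22:
  shows "\<not> (\<exists>F. is_clause_set F \<and> unsatisfiable F \<and> hitting F \<and> clause_irreducible F \<and>
              deficiency F = 2 \<and> nfs_irreducible F) \<and>
         (\<forall>F. is_clause_set F \<and> unsatisfiable F \<and> hitting F \<and> clause_irreducible F \<and>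
              deficiency F = 2 \<longrightarrow>
              (\<exists>G. nfs_flip\<^sup>*\<^sup>* F G \<and> clause_reducible G))"
proof -
  have "\<exists>G. nfs_flip\<^sup>*\<^sup>* F G \<and> clause_reducible G"
    if "is_clause_set F" "unsatisfiable F" "hitting F" "clause_irreducible F" "deficiency F = 2" for F
    using clause_irreducible_deficiency_2[of F] that unfolding uhit_def
    by (metis r_into_rtranclp)
  then show ?thesis unfolding nfs_irreducible_def by blast
qed

end
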